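(* Let goals, the two lemma-synthesis tactics (Tactic 1 and Tactic 2) and the induction-friendly forms (F1) and (F2) be as defined in the context. Starting from any goal, if all lemmas requested by the tactics are successfully synthesized, then the initial goal can be eventually (i.e. after finitely many tactic applications) transformed into an induction-friendly form, that is, into a goal whose equation satisfies (F1) or (F2).
   Context: Types and programs. There is one built-in type $\mathtt{Int}$ and one algebraic data type $\mathtt{List}$ with constructors $\mathtt{nil}:\mathtt{List}$ and $\mathtt{cons}:\mathtt{Int}\to\mathtt{List}\to\mathtt{List}$. Programs are the well-typed terms generated from variables, integer constants, applications of primitive operators on $\mathtt{Int}$, applications of constructors, and applications of CSRs. A canonical structural recursion (CSR) $f$ with $k$ arguments is a function whose last argument, called the recursive argument, has type $\mathtt{List}$, given by programs $base$ and $comb$ (which may use previously defined CSRs) via $f\ v_1\ldots v_{k-1}\ \mathtt{nil}=base(v_1,\ldots,v_{k-1})$ and $f\ v_1\ldots v_{k-1}\ (\mathtt{cons}\ h\ t)=comb(v_1,\ldots,v_{k-1},h,f\ v_1\ldots v_{k-1}\ t)$. A goal is a pair $(\mathtt{pr},\mathtt{eq})$ where $\mathtt{pr}$ is a set of equations (premises: lemmas and inductive hypotheses) and $\mathtt{eq}$ is an equation $\forall\bar x.\ p_1(\bar x)=p_2(\bar x)$ between programs; the target is to prove $\mathtt{pr}\vdash\mathtt{eq}$. Induction-friendly forms. (F1): equations $f\ v_1\ldots v_k=p(v_1,\ldots,v_k)$ with (F1.1) one side of the form $f\ v_1\ldots v_k$, $f$ a CSR and $v_1,\ldots,v_k$ pairwise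 different variables; and (F1.2) if $v_k$ appears in the other side $p$, then there exists an occurrence of $v_k$ in $p$ such that $v_k$ is the recursive argument of the CSR it is passed to and all other arguments of this CSR invocation do not contain $v_k$. (F2): equations $f\ v_1\ldots v_k=f'\ v_1'\ldots v_k'$ where each side is a single CSR call whose arguments are pairwise distinct variables. An abstraction of a program $p$ is a program obtained from $p$ by steps, each replacing a subprogram by a fresh variable. Tactics, general scheme. A tactic extracts from $\mathtt{eq}$ a pair $(p_s',v)$, where $p_s'$ is an abstraction of a subprogram of $\mathtt{eq}$ and $v$ is a free variable of $p_s'$. It then asks to synthesize a CSR $f^*$ giving the lemma $\forall\tilde v.\forall v.\ f^*\ \tilde v\ v=p_s'(\tilde v,v)$, where $\tilde v$ are all free variables of $p_s'$ other than $v$. If synthesis succeeds, the lemma is used to rewrite the abstracted subprogram in $\mathtt{eq}$ (the instance of $p_s'$ is replaced by the corresponding instance of $f^*\ \tilde v\ v$), giving a new equation $\mathtt{eq}'$. The goal $(\mathtt{pr},\mathtt{eq})$ is thereby replaced by the goal $(\mathtt{pr},\text{lemma})$ and the goal $(\mathtt{pr}\cup\{\text{lemma}\},\mathtt{eq}')$. Tactics are applied, recursively, only to goals whose equation is in neither form (F1) nor form (F2). Tactic 1 (removing compositions). Applicable iff $\mathtt{eq}$ does not satisfy (F1.1). Extraction: pick a non-leaf subprogram $c\ p_1\ldots p_k$ of some side of $\mathtt{eq}$, where $c$ is a primitive operator, a constructor or a CSR and at least one $p_i$ is not a variable; abstract all arguments passed to each $p_i$ by fresh variables, obtaining $p_s'$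 (e.g. $\mathtt{rev}\ (\mathtt{rev}\ (\mathtt{app}\ (\mathtt{rev}\ a)\ b))$ is abstracted to $\mathtt{rev}\ (\mathtt{rev}\ x)$). The cost is the number of fresh variables introduced; a choice of minimum cost is taken (ties arbitrary). Then $v$ is chosen as a variable of $p_s'$ for which the corresponding lemma fulfills the maximum number of the conditions (F1.1), (F1.2), (F2) (ties arbitrary). Tactic 2 (switching recursive arguments). Applicable iff $\mathtt{eq}$ satisfies (F1.1) but not (F1.2). Let the side that is a single CSR invocation have recursive argument $x$. Extraction: pick the occurrence of $x$ of maximum depth in the syntax tree (of the other side) where $x$ is passed to a CSR $f$, in a call $f\ p_1\ldots p_k$; abstract $p_1,\ldots,p_k$ by fresh variables $v_1,\ldots,v_k$, and for some $1\le i<k$ with $p_i=x$ output $p_s'=f\ v_1\ldots v_k$ and $v=v_i$.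
   Formalization: Assumes each reached goal in neither form admits a request (x+y=y+x admits none); Tactic 2 abstracts all copies of the switched variable by one variable (else f y x = g x x y loops); Tactic 1 considers only abstractions containing a List variable. *)

theory Defs
  imports Main
begin

text \<open>
  Variables carry their type, so that no typing contexts are needed.  The class \<open>primop\<close>
  describes the otherwise arbitrary primitive operators on integers.
\<close>

datatype ty = TInt | TList

datatype var = V (vname: nat) (vty: ty)

class primop =
  fixes arity :: "'a \<Rightarrow> nat"
    and prim_sem :: "'a \<Rightarrow> int list \<Rightarrow> int"

text \<open>
  \<open>CSR vs b h r c\<close> is the canonical structural recursion \<open>f\<close> with
    \<open>f vs nil = b\<close>  and  \<open>f vs (cons h t) = c[r := f vs t]\<close>;
  it binds \<open>vs\<close> in \<open>b\<close>, and \<open>vs\<close>, \<open>h\<close>, \<open>r\<close> in \<open>c\<close>.  Since a CSR is a finite term that contains its two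
  bodies, the bodies can only call CSRs that are defined before it.
\<close>

datatype 'op prog = Var var | App "'op head" "'op prog list"
  and 'op head = IntConst int | Prim 'op | NilC | ConsC
    | CSR "var list" "'op prog" var var "'op prog"

fun is_CSR :: "'op head \<Rightarrow> bool" where
  "is_CSR (CSR _ _ _ _ _) = True"
| "is_CSR _ = False"

fun var_list :: "'op prog \<Rightarrow> var list" where
  "var_list (Var x) = [x]"
| "var_list (App _ ps) = concat (map var_list ps)"

abbreviation fv :: "'op prog \<Rightarrow> var set" where
  "fv p \<equiv> set (var_list p)"

fun subst :: "(var \<Rightarrow> 'op prog) \<Rightarrow> 'op prog \<Rightarrow> 'op prog" where
  "subst \<sigma> (Var x) = \<sigma> x"
| "subst \<sigma> (App c ps) = App c (map (subst \<sigma>) ps)"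

inductive has_ty :: "'op::primop prog \<Rightarrow> ty \<Rightarrow> bool"
  and head_ty :: "'op head \<Rightarrow> ty list \<Rightarrow> ty \<Rightarrow> bool" where
  "has_ty (Var x) (vty x)"
| "head_ty c \<tau>s \<tau> \<Longrightarrow> list_all2 has_ty ps \<tau>s \<Longrightarrow> has_ty (App c ps) \<tau>"
| "head_ty (IntConst n) [] TInt"
| "head_ty (Prim f) (replicate (arity f) TInt) TInt"
| "head_ty NilC [] TList"
| "head_ty ConsC [TInt, TList] TList"
| "distinct (vs @ [h, r]) \<Longrightarrow> vty h = TInt \<Longrightarrow> vty r = \<tau> \<Longrightarrow>
   fv b \<subseteq> set vs \<Longrightarrow> fv c \<subseteq> set vs \<union> {h, r} \<Longrightarrow> has_ty b \<tau> \<Longrightarrow> has_ty c \<tau> \<Longrightarrow>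
   head_ty (CSR vs b h r c) (map vty vs @ [TList]) \<tau>"

datatype val = VInt (the_int: int) | VList (the_list: "int list")

fun val_ty :: "val \<Rightarrow> ty" where
  "val_ty (VInt _) = TInt"
| "val_ty (VList _) = TList"

definition bind :: "var list \<Rightarrow> val list \<Rightarrow> var \<Rightarrow> val" where
  "bind vs us x = (case map_of (zip vs us) x of Some u \<Rightarrow> u | None \<Rightarrow> VInt 0)"

primrec eval :: "'op::primop prog \<Rightarrow> (var \<Rightarrow> val) \<Rightarrow> val"
  and head_val :: "'op head \<Rightarrow> val list \<Rightarrow> val" where
  "eval (Var x) = (\<lambda>\<rho>. \<rho> x)"
| "eval (App c ps) = (\<lambda>\<rho>. head_val c (map (\<lambda>p. eval p \<rho>) ps))"
| "head_val (IntConst n) = (\<lambda>us. VInt n)"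
| "head_val (Prim f) = (\<lambda>us. VInt (prim_sem f (map the_int us)))"
| "head_val NilC = (\<lambda>us. VList [])"
| "head_val ConsC = (\<lambda>us. VList (the_int (us ! 0) # the_list (us ! 1)))"
| "head_val (CSR vs b h r c) = (\<lambda>us.
     foldr (\<lambda>n u. eval c ((bind vs (butlast us))(h := VInt n, r := u)))
       (the_list (last us)) (eval b (bind vs (butlast us))))"

lemma csr_nil:
  "head_val (CSR vs b h r c) (us @ [VList []]) = eval b (bind vs us)"
  by simp

lemma csr_cons:
  "head_val (CSR vs b h r c) (us @ [VList (n # ns)]) =
   eval c ((bind vs us)(h := VInt n, r := head_val (CSR vs b h r c) (us @ [VList ns])))"
  by simp

type_synonym 'op eqn = "'op prog \<times> 'op prog"
type_synonym 'op goal = "'op eqn set \<times> 'op eqn"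

definition wf_eqn :: "'op::primop eqn \<Rightarrow> bool" where
  "wf_eqn e \<longleftrightarrow> (\<exists>\<tau>. has_ty (fst e) \<tau> \<and> has_ty (snd e) \<tau>)"

definition wf_goal :: "'op::primop goal \<Rightarrow> bool" where
  "wf_goal G \<longleftrightarrow> (\<forall>e\<in>fst G. wf_eqn e) \<and> wf_eqn (snd G)"

definition valid_eqn :: "'op::primop eqn \<Rightarrow> bool" where
  "valid_eqn e \<longleftrightarrow> (\<forall>\<rho>. (\<forall>x. val_ty (\<rho> x) = vty x) \<longrightarrow> eval (fst e) \<rho> = eval (snd e) \<rho>)"

definition eqn_vars :: "'op eqn \<Rightarrow> var set" where
  "eqn_vars e = fv (fst e) \<union> fv (snd e)"

text \<open>Equations are symmetric: \<open>orient True\<close> exchanges the two sides.\<close>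

fun orient :: "bool \<Rightarrow> 'op eqn \<Rightarrow> 'op eqn" where
  "orient b (p, q) = (if b then (q, p) else (p, q))"

text \<open>Occurrences of subprograms are given by one-hole contexts.\<close>

datatype 'op ctxt = Hole | In "'op head" "'op prog list" "'op ctxt" "'op prog list"

fun fill :: "'op ctxt \<Rightarrow> 'op prog \<Rightarrow> 'op prog" where
  "fill Hole p = p"
| "fill (In c ps C qs) p = App c (ps @ fill C p # qs)"

fun depth :: "'op ctxt \<Rightarrow> nat" where
  "depth Hole = 0"
| "depth (In _ _ C _) = Suc (depth C)"

text \<open>\<open>csr_call p vs x\<close>: \<open>p\<close> calls a CSR on pairwise different variables, with recursive argument \<open>x\<close>.\<close>

definition csr_call :: "'op prog \<Rightarrow> var list \<Rightarrow> var \<Rightarrow> bool" where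
  "csr_call p vs x \<longleftrightarrow>
     (\<exists>f. is_CSR f \<and> p = App f (map Var (vs @ [x]))) \<and> distinct (vs @ [x])"

definition F1_1 :: "'op eqn \<Rightarrow> bool" where
  "F1_1 e \<longleftrightarrow> (\<exists>b p q vs x. orient b e = (p, q) \<and> csr_call p vs x)"

text \<open>Condition (F1.2) refers to the side singled out by (F1.1), so it is stated together with it.\<close>

definition F1_2 :: "'op eqn \<Rightarrow> bool" where
  "F1_2 e \<longleftrightarrow> (\<exists>b p q vs x. orient b e = (p, q) \<and> csr_call p vs x \<and>
     (x \<in> fv q \<longrightarrow> (\<exists>C g ps. q = fill C (App g (ps @ [Var x])) \<and> is_CSR g \<and>
        (\<forall>p'\<in>set ps. x \<notin> fv p'))))"

definition F1 :: "'op eqn \<Rightarrow> bool" where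
  "F1 e \<longleftrightarrow> F1_1 e \<and> F1_2 e"

definition F2 :: "'op eqn \<Rightarrow> bool" where
  "F2 e \<longleftrightarrow> (\<exists>vs x vs' x'. csr_call (fst e) vs x \<and> csr_call (snd e) vs' x' \<and>
     length vs = length vs')"

definition induction_friendly :: "'op eqn \<Rightarrow> bool" where
  "induction_friendly e \<longleftrightarrow> F1 e \<or> F2 e"

text \<open>
  An abstraction \<open>s\<close> of a subprogram \<open>p\<close> of \<open>e\<close> is given by a set \<open>X\<close> of fresh variables and the
  substitution \<open>\<sigma>\<close> that maps them back to the subprograms they replace, so that \<open>subst \<sigma> s = p\<close>.
  Equal subprograms may be replaced by the same or by different fresh variables.
\<close>

definition fresh_subst :: "'op::primop eqn \<Rightarrow> var set \<Rightarrow> (var \<Rightarrow> 'op prog) \<Rightarrow> bool" where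
  "fresh_subst e X \<sigma> \<longleftrightarrow> X \<inter> eqn_vars e = {} \<and>
     (\<forall>y\<in>X. has_ty (\<sigma> y) (vty y)) \<and> (\<forall>y. y \<notin> X \<longrightarrow> \<sigma> y = Var y)"

definition other_vars :: "'op prog \<Rightarrow> var \<Rightarrow> var list" where
  "other_vars s v = removeAll v (remdups (var_list s))"

definition new_call :: "'op head \<Rightarrow> 'op prog \<Rightarrow> var \<Rightarrow> 'op prog" where
  "new_call f s v = App f (map Var (other_vars s v @ [v]))"

definition lemma_eqn :: "'op head \<Rightarrow> 'op prog \<Rightarrow> var \<Rightarrow> 'op eqn" where
  "lemma_eqn f s v = (new_call f s v, s)"

text \<open>
  A synthesizer answers requests \<open>(s, v)\<close>.  It is a relation: it may fail on a request, and it may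
  have several answers.  Every answer is a CSR for which the lemma is well-typed and true.
\<close>

type_synonym 'op synthesizer = "'op prog \<Rightarrow> var \<Rightarrow> 'op head \<Rightarrow> bool"

definition sound_synthesizer :: "'op::primop synthesizer \<Rightarrow> bool" where
  "sound_synthesizer synth \<longleftrightarrow> (\<forall>s v f. synth s v f \<longrightarrow>
     is_CSR f \<and> wf_eqn (lemma_eqn f s v) \<and> valid_eqn (lemma_eqn f s v))"

text \<open>
  An extraction \<open>(b, C, q, X, \<sigma>, s, v)\<close> from \<open>e\<close> abstracts the subprogram \<open>subst \<sigma> s\<close>, which occurs
  at \<open>C\<close> in one of the sides of \<open>e\<close>; the other side is \<open>q\<close>.
\<close>

definition occurs_at ::
  "'op::primop eqn \<Rightarrow> bool \<Rightarrow> 'op ctxt \<Rightarrow> 'op prog \<Rightarrow> var set \<Rightarrow> (var \<Rightarrow> 'op prog) \<Rightarrow> 'op prog \<Rightarrow> bool"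
  where "occurs_at e b C q X \<sigma> s \<longleftrightarrow> orient b e = (fill C (subst \<sigma> s), q) \<and> fresh_subst e X \<sigma>"

text \<open>
  Tactic 1: in \<open>c p\<^sub>1 \<dots> p\<^sub>k\<close>, variables among the \<open>p\<^sub>i\<close> stay as they are, and all arguments of the other
  \<open>p\<^sub>i\<close> are replaced by fresh variables.  As the requested lemma is well-typed only if \<open>v\<close> is a list,
  only abstractions that contain a list variable give rise to an extraction.
\<close>

definition tac1_choice ::
  "'op::primop eqn \<Rightarrow> bool \<Rightarrow> 'op ctxt \<Rightarrow> 'op prog \<Rightarrow> var set \<Rightarrow> (var \<Rightarrow> 'op prog) \<Rightarrow> 'op prog \<Rightarrow> bool"
  where "tac1_choice e b C q X \<sigma> s \<longleftrightarrow> occurs_at e b C q X \<sigma> s \<and>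
     (\<exists>c ts. s = App c ts \<and>
        (\<forall>t\<in>set ts. (\<exists>x. t = Var x \<and> x \<notin> X) \<or> (\<exists>d ys. t = App d (map Var ys) \<and> set ys \<subseteq> X)) \<and>
        (\<exists>t\<in>set ts. \<forall>x. t \<noteq> Var x)) \<and>
     (\<exists>v\<in>fv s. vty v = TList)"

definition cost :: "var set \<Rightarrow> 'op prog \<Rightarrow> nat" where
  "cost X s = card (X \<inter> fv s)"

definition score :: "'op eqn \<Rightarrow> nat" where
  "score e = of_bool (F1_1 e) + of_bool (F1_2 e) + of_bool (F2 e)"

definition best_var :: "'op prog \<Rightarrow> var \<Rightarrow> bool" where
  "best_var s v \<longleftrightarrow> v \<in> fv s \<and> vty v = TList \<and>
     (\<forall>v'\<in>fv s. vty v' = TList \<longrightarrow>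
        (\<forall>f f'. is_CSR f \<and> is_CSR f' \<longrightarrow> score (lemma_eqn f' s v') \<le> score (lemma_eqn f s v)))"

definition tac1 ::
  "'op::primop eqn \<Rightarrow> bool \<Rightarrow> 'op ctxt \<Rightarrow> 'op prog \<Rightarrow> var set \<Rightarrow> (var \<Rightarrow> 'op prog) \<Rightarrow> 'op prog \<Rightarrow> var \<Rightarrow> bool"
  where "tac1 e b C q X \<sigma> s v \<longleftrightarrow> \<not> F1_1 e \<and> tac1_choice e b C q X \<sigma> s \<and>
     (\<forall>b' C' q' X' \<sigma>' s'. tac1_choice e b' C' q' X' \<sigma>' s' \<longrightarrow> cost X s \<le> cost X' s') \<and>
     best_var s v"

text \<open>
  Tactic 2.  If \<open>x\<close> is passed several times to the selected call, all these arguments are replaced by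
  the one variable \<open>v\<close>.  (With different variables, \<open>f y x = g x x y\<close> would become
  \<open>f y x = g' x y x\<close>, then \<open>f y x = g'' y x x\<close>, and so on without end.)
\<close>

definition passed_at :: "'op prog \<Rightarrow> var \<Rightarrow> 'op ctxt \<Rightarrow> bool" where
  "passed_at p x C \<longleftrightarrow> (\<exists>g ps. p = fill C (App g ps) \<and> is_CSR g \<and> Var x \<in> set ps)"

definition tac2 ::
  "'op::primop eqn \<Rightarrow> bool \<Rightarrow> 'op ctxt \<Rightarrow> 'op prog \<Rightarrow> var set \<Rightarrow> (var \<Rightarrow> 'op prog) \<Rightarrow> 'op prog \<Rightarrow> var \<Rightarrow> bool"
  where "tac2 e b C q X \<sigma> s v \<longleftrightarrow> F1_1 e \<and> \<not> F1_2 e \<and> occurs_at e b C q X \<sigma> s \<and>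
     (\<exists>vs x g ys. csr_call q vs x \<and>
        passed_at (fill C (subst \<sigma> s)) x C \<and>
        (\<forall>C'. passed_at (fill C (subst \<sigma> s)) x C' \<longrightarrow> depth C' \<le> depth C) \<and>
        is_CSR g \<and> s = App g (map Var ys) \<and> set ys \<subseteq> X \<and>
        v \<in> set (butlast ys) \<and> \<sigma> v = Var x \<and> (\<forall>y\<in>set ys. \<sigma> y = Var x \<longrightarrow> y = v))"

definition extracts ::
  "'op::primop eqn \<Rightarrow> bool \<Rightarrow> 'op ctxt \<Rightarrow> 'op prog \<Rightarrow> var set \<Rightarrow> (var \<Rightarrow> 'op prog) \<Rightarrow> 'op prog \<Rightarrow> var \<Rightarrow> bool"
  where "extracts e b C q X \<sigma> s v \<longleftrightarrow>
     \<not> induction_friendly e \<and> (tac1 e b C q X \<sigma> s v \<or> tac2 e b C q X \<sigma> s v)"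

text \<open>
  There are equations in neither form that admit no extraction, such as \<open>x + y = y + x\<close>, or \<open>f x = x\<close>
  for a CSR \<open>f\<close>.
\<close>

definition requests :: "'op::primop eqn \<Rightarrow> 'op prog \<Rightarrow> var \<Rightarrow> bool" where
  "requests e s v \<longleftrightarrow> (\<exists>b C q X \<sigma>. extracts e b C q X \<sigma> s v)"

text \<open>\<open>tactic_step synth G G\<^sub>1 G\<^sub>2\<close>: one application of Tactic 1 or Tactic 2 replaces \<open>G\<close> by the lemma goal \<open>G\<^sub>1\<close> and the goal \<open>G\<^sub>2\<close>.\<close>

inductive tactic_step :: "'op::primop synthesizer \<Rightarrow> 'op goal \<Rightarrow> 'op goal \<Rightarrow> 'op goal \<Rightarrow> bool"
  for synth where
  "extracts e b C q X \<sigma> s v \<Longrightarrow> synth s v f \<Longrightarrow>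
   tactic_step synth (pr, e)
     (pr, lemma_eqn f s v)
     (insert (lemma_eqn f s v) pr, orient b (fill C (subst \<sigma> (new_call f s v)), q))"

definition transforms :: "'op::primop synthesizer \<Rightarrow> 'op goal \<Rightarrow> 'op goal \<Rightarrow> bool" where
  "transforms synth G G' \<longleftrightarrow> (\<exists>G\<^sub>1. tactic_step synth G G\<^sub>1 G')"

end

theory Submission
  imports Defs
begin

text \<open>
  A lemma call \<open>f\<^sup>* \<tilde>v v\<close> contains every variable of the abstraction \<open>s\<close> exactly once, so a rewriting step
  copies no subprogram.  Tactic 1 replaces at least two heads by one and so decreases the number of
  heads.  Tactic 2 does not increase it.  It is applied when one side is a CSR call on distinct
  variables with recursive argument \<open>x\<close>, and it decreases the number of places of the other side where
  \<open>x\<close> itself is passed as a non-final argument.  That side may turn into such a call as well, but then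
  its recursive argument is again \<open>x\<close>, so both readings of the equation can be measured at once.
\<close>

section \<open>The two quantities of the termination measure\<close>

fun heads :: "'op prog \<Rightarrow> nat" where
  "heads (Var x) = 0"
| "heads (App c ps) = Suc (\<Sum>p\<leftarrow>ps. heads p)"

text \<open>All kinds of head are treated alike: rewriting changes a single call, and the count
  outside it stays constant.\<close>

fun nonfinal :: "var \<Rightarrow> 'op prog \<Rightarrow> nat" where
  "nonfinal x (Var y) = 0"
| "nonfinal x (App c ps) = count_list (butlast ps) (Var x) + (\<Sum>p\<leftarrow>ps. nonfinal x p)"

text \<open>Here \<open>q\<close> is read as the single call of (F1.1), which supplies the variable
  whose occurrences in \<open>p\<close> are counted.\<close>

definition switches :: "'op prog \<Rightarrow> 'op prog \<Rightarrow> nat" where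
  "switches p q = (if \<exists>vs x. csr_call q vs x then nonfinal (THE x. \<exists>vs. csr_call q vs x) p else 0)"

definition eqn_heads :: "'op eqn \<Rightarrow> nat" where
  "eqn_heads e = heads (fst e) + heads (snd e)"

definition eqn_switches :: "'op eqn \<Rightarrow> nat" where
  "eqn_switches e = switches (fst e) (snd e) + switches (snd e) (fst e)"

section \<open>Heads under substitution and rewriting\<close>

lemma sum_set_le_sum_list: "(\<Sum>x\<in>set xs. h x) \<le> (\<Sum>x\<leftarrow>xs. h x :: nat)"
  by (induction xs) (auto simp: sum.insert_if)

text \<open>The arguments of the new call list each variable of \<open>s\<close> once, whereas
  \<open>var_list s\<close> repeats it for every occurrence. With \<open>h\<close> measuring what is
  substituted for a variable, this says that rewriting copies nothing.\<close>

lemma sum_list_other_vars_le: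
  assumes "v \<in> fv s"
  shows "(\<Sum>x\<leftarrow>other_vars s v. h x) + h v \<le> (\<Sum>x\<leftarrow>var_list s. h x :: nat)"
proof -
  let ?ys = "other_vars s v @ [v]"
  have "distinct ?ys" and "set ?ys = fv s"
    using assms by (auto simp: other_vars_def distinct_removeAll)
  then have "(\<Sum>x\<leftarrow>?ys. h x) = (\<Sum>x\<in>fv s. h x)"
    by (metis sum_list_distinct_conv_sum_set)
  then show ?thesis
    using sum_set_le_sum_list[of h "var_list s"] by simp
qed

lemma heads_subst: "heads (subst \<sigma> s) = heads s + (\<Sum>x\<leftarrow>var_list s. heads (\<sigma> x))"
proof (induction s rule: heads.induct)
  case (2 c ps)
  then have "(\<Sum>p\<leftarrow>ps. heads (subst \<sigma> p)) =
      (\<Sum>p\<leftarrow>ps. heads p) + (\<Sum>x\<leftarrow>concat (map var_list ps). heads (\<sigma> x))"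
    by (induction ps) auto
  then show ?case
    by (simp add: comp_def)
qed simp

lemma subst_new_call:
  "subst \<sigma> (new_call f s v) = App f (map \<sigma> (other_vars s v) @ [\<sigma> v])"
  by (simp add: new_call_def)

text \<open>The single head \<open>f\<close> takes the place of all heads of \<open>s\<close>. The
  additive form avoids truncated subtraction.\<close>

lemma heads_new_call_le:
  assumes "v \<in> fv s"
  shows "heads (subst \<sigma> (new_call f s v)) + heads s \<le> Suc (heads (subst \<sigma> s))"
  using sum_list_other_vars_le[OF assms, of "\<lambda>x. heads (\<sigma> x)"]
  by (simp add: subst_new_call heads_subst[of \<sigma> s] comp_def)

lemma heads_ge_2:
  assumes "s = App c ts" and "t \<in> set ts" and "\<forall>x. t \<noteq> Var x"
  shows "2 \<le> heads s"
proof -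
  have "1 \<le> heads t"
    using assms(3) by (cases t) auto
  also have "heads t \<le> (\<Sum>p\<leftarrow>ts. heads p)"
    using assms(2) by (simp add: member_le_sum_list)
  finally show ?thesis
    by (simp add: assms(1))
qed

lemma heads_fill: "heads (fill C p) + heads q = heads (fill C q) + heads p"
  by (induction C) auto

section \<open>Non-final occurrences of the recursive argument\<close>

lemma nonfinal_fill:
  assumes "\<forall>y. p \<noteq> Var y" and "\<forall>y. q \<noteq> Var y"
  shows "nonfinal x (fill C p) + nonfinal x q = nonfinal x (fill C q) + nonfinal x p"
proof (induction C)
  case (In c ps C qs)
  \<comment> \<open>Applications stay applications in every context, so the argument holding the
    hole is never itself counted, whether or not \<open>butlast\<close> drops it.\<close>
  have "fill C p \<noteq> Var x" and "fill C q \<noteq> Var x"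
    using assms by (cases C; simp)+
  then have "count_list (butlast (ps @ fill C p # qs)) (Var x) =
      count_list (butlast (ps @ fill C q # qs)) (Var x)"
    by (cases qs) (simp_all add: butlast_append)
  with In show ?case
    by simp
qed simp

text \<open>The recursive argument is the last entry of the argument list; this justifies the
  \<open>THE\<close> in \<open>switches\<close>.\<close>

lemma csr_call_unique:
  assumes "csr_call p vs x" and "csr_call p vs' x'"
  shows "x = x'"
proof -
  have "map Var (vs @ [x]) = (map Var (vs' @ [x']) :: 'a prog list)"
    using assms by (auto simp: csr_call_def)
  then show ?thesis
    by simp
qed

lemma switches_csr_call:
  assumes "csr_call q vs x"
  shows "switches p q = nonfinal x p"
proof -
  have "(THE x. \<exists>vs. csr_call q vs x) = x"
    using assms csr_call_unique[OF _ assms] by (intro the_equality) blast+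
  then show ?thesis
    using assms by (auto simp: switches_def)
qed

text \<open>Distinctness keeps \<open>x\<close> out of all positions but the last.\<close>

lemma nonfinal_csr_call:
  assumes "csr_call p vs x"
  shows "nonfinal x p = 0"
proof -
  obtain f where p: "p = App f (map Var (vs @ [x]))" and "x \<notin> set vs"
    using assms by (auto simp: csr_call_def)
  then have "Var x \<notin> set (map Var vs)"
    by auto
  then have "count_list (map Var vs) (Var x) = 0"
    by (simp only: count_list_0_iff)
  then show ?thesis
    by (simp add: p comp_def)
qed

text \<open>Controls the case in which the rewritten side becomes a call on variables. That forces
  the context to be empty, since otherwise some argument would be an application.\<close>

lemma csr_call_fill_AppD:
  assumes "csr_call (fill C (App f (ps @ [Var x]))) vs x'"
  shows "x' = x"
proof (cases C)
  case Hole
  then have "ps @ [Var x] = map Var vs @ [Var x']"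
    using assms by (auto simp: csr_call_def)
  then show ?thesis
    by simp
next
  case (In c qs D rs)
  then have "qs @ fill D (App f (ps @ [Var x])) # rs = map Var (vs @ [x'])"
    using assms by (simp add: csr_call_def)
  then have "fill D (App f (ps @ [Var x])) \<in> set (map Var (vs @ [x']))"
    by (metis in_set_conv_decomp)
  then show ?thesis
    by (cases D) auto
qed

text \<open>The old call has \<open>x\<close> in at least one non-final position; the new one has it
  only in the final position, which is not counted.\<close>

lemma nonfinal_new_call_less:
  assumes "s = App g (map Var ys)" and "v \<in> set (butlast ys)" and "\<sigma> v = Var x"
    and "\<forall>y\<in>set ys. \<sigma> y = Var x \<longrightarrow> y = v"
  shows "nonfinal x (subst \<sigma> (new_call f s v)) < nonfinal x (subst \<sigma> s)"
proof -
  have vars: "var_list s = ys"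
    by (simp add: assms(1) comp_def)
  have v: "v \<in> fv s"
    using assms(2) vars in_set_butlastD by metis
  \<comment> \<open>This is where it matters that \<open>v\<close> alone stands for
    \<open>x\<close>: a second such variable would remain non-final.\<close>
  have "Var x \<notin> set (map \<sigma> (other_vars s v))"
    using assms(4) unfolding other_vars_def vars by force
  then have "nonfinal x (subst \<sigma> (new_call f s v)) = (\<Sum>y\<leftarrow>other_vars s v. nonfinal x (\<sigma> y))"
    by (simp add: subst_new_call assms(3) comp_def)
  also have "\<dots> \<le> (\<Sum>y\<leftarrow>ys. nonfinal x (\<sigma> y))"
    using sum_list_other_vars_le[OF v, of "\<lambda>y. nonfinal x (\<sigma> y)"] vars by simp
  also have "\<dots> < nonfinal x (subst \<sigma> s)"
  proof -
    have "Var x \<in> set (map \<sigma> (butlast ys))"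
      using assms(2,3) by force
    then have "count_list (map \<sigma> (butlast ys)) (Var x) > 0"
      using count_list_0_iff by fastforce
    then show ?thesis
      by (simp add: assms(1) comp_def map_butlast)
  qed
  finally show ?thesis .
qed

section \<open>Decrease under rewriting of equations\<close>

lemma eqn_heads_orient: "eqn_heads (orient b (p, q)) = heads p + heads q"
  by (simp add: eqn_heads_def)

lemma eqn_switches_orient: "eqn_switches (orient b (p, q)) = switches p q + switches q p"
  by (simp add: eqn_switches_def)

text \<open>\<open>orient b\<close> is an involution.\<close>

lemma orient_flip: "orient b e = (p, q) \<Longrightarrow> e = orient b (p, q)"
  by (cases e) (auto split: if_splits)

lemma tac1_decreases:
  assumes "tac1 e b C q X \<sigma> s v"
  shows "eqn_heads (orient b (fill C (subst \<sigma> (new_call f s v)), q)) < eqn_heads e"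
proof -
  have v: "v \<in> fv s" and e: "e = orient b (fill C (subst \<sigma> s), q)"
    using assms by (auto simp: tac1_def best_var_def tac1_choice_def occurs_at_def dest: orient_flip)
  have "2 \<le> heads s"
    using assms heads_ge_2 unfolding tac1_def tac1_choice_def by blast
  then show ?thesis
    using heads_new_call_le[OF v, of \<sigma> f] heads_fill[of C "subst \<sigma> s" "subst \<sigma> (new_call f s v)"]
    by (simp add: e eqn_heads_orient del: orient.simps)
qed

lemma tac2_decreases:
  fixes f :: "'op::primop head"
  assumes "tac2 e b C q X \<sigma> s v"
  defines "e' \<equiv> orient b (fill C (subst \<sigma> (new_call f s v)), q)"
  shows "eqn_heads e' \<le> eqn_heads e" and "eqn_switches e' < eqn_switches e"
proof -
  let ?p = "fill C (subst \<sigma> s)" and ?p' = "fill C (subst \<sigma> (new_call f s v))"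
  obtain vs x g ys where q: "csr_call q vs x" and s: "s = App g (map Var ys)"
    and v: "v \<in> set (butlast ys)" and \<sigma>v: "\<sigma> v = Var x"
    and only: "\<forall>y\<in>set ys. \<sigma> y = Var x \<longrightarrow> y = v"
    using assms(1) unfolding tac2_def by blast
  have e: "e = orient b (?p, q)"
    using assms(1) by (auto simp: tac2_def occurs_at_def dest: orient_flip)
  have "v \<in> fv s"
    using v in_set_butlastD by (fastforce simp: s comp_def)
  moreover have "1 \<le> heads s"
    by (simp add: s)
  ultimately show "eqn_heads e' \<le> eqn_heads e"
    using heads_new_call_le[of v s \<sigma> f] heads_fill[of C "subst \<sigma> s" "subst \<sigma> (new_call f s v)"]
    by (simp add: e e'_def eqn_heads_orient del: orient.simps)
  have "nonfinal x ?p' < nonfinal x ?p"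
    using nonfinal_new_call_less[OF s v \<sigma>v only, of f]
      nonfinal_fill[of "subst \<sigma> s" "subst \<sigma> (new_call f s v)" x C]
    by (simp add: s subst_new_call)
  then have "switches ?p' q < switches ?p q"
    by (simp add: switches_csr_call[OF q])
  \<comment> \<open>The reverse reading contributes nothing: if \<open>?p'\<close> is a call on
    distinct variables, its recursive argument is again \<open>x\<close>, and \<open>q\<close> has
    \<open>x\<close> only in final position.\<close>
  moreover have "switches q ?p' = 0"
  proof (cases "\<exists>vs' x'. csr_call ?p' vs' x'")
    case True
    then obtain vs' where "csr_call ?p' vs' x"
      using csr_call_fill_AppD by (fastforce simp: subst_new_call \<sigma>v)
    then show ?thesis
      by (simp add: switches_csr_call nonfinal_csr_call[OF q])
  qed (simp add: switches_def)
  ultimately show "eqn_switches e' < eqn_switches e"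
    by (simp add: e e'_def eqn_switches_orient del: orient.simps)
qed

text \<open>Heads come first in the lexicographic order because a \<open>tac1\<close> step can
  create a single call and thereby raise \<open>eqn_switches\<close> from 0.\<close>

lemma transforms_decreases:
  assumes "transforms synth G G'"
  shows "(G', G) \<in> inv_image (less_than <*lex*> less_than)
    (\<lambda>G. (eqn_heads (snd G), eqn_switches (snd G)))"
proof -
  obtain b C q X \<sigma> s v f where ex: "extracts (snd G) b C q X \<sigma> s v"
    and G': "snd G' = orient b (fill C (subst \<sigma> (new_call f s v)), q)"
    using assms unfolding transforms_def by (auto elim!: tactic_step.cases simp del: orient.simps)
  from ex consider "tac1 (snd G) b C q X \<sigma> s v" | "tac2 (snd G) b C q X \<sigma> s v"
    unfolding extracts_def by blast
  then show ?thesis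
  proof cases
    case 1
    show ?thesis
      using tac1_decreases[OF 1, of f] by (simp add: G' del: orient.simps)
  next
    case 2
    show ?thesis
      using tac2_decreases[OF 2, of f] by (auto simp: G' simp del: orient.simps)
  qed
qed

section \<open>Termination and progress\<close>

lemma wf_transforms: "wf {(G', G). transforms synth G G'}"
proof (rule wf_subset)
  show "wf (inv_image (less_than <*lex*> less_than)
      (\<lambda>G :: 'a goal. (eqn_heads (snd G), eqn_switches (snd G))))"
    by (intro wf_inv_image wf_lex_prod wf_less_than)
qed (use transforms_decreases in blast)

lemma requests_transforms:
  assumes "requests (snd G) s v" and "synth s v f"
  shows "\<exists>G'. transforms synth G G'"
proof -
  obtain b C q X \<sigma> where "extracts (snd G) b C q X \<sigma> s v"
    using assms(1) unfolding requests_def by blast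
  from tactic_step.intros[of _ _ _ _ _ _ _ _ synth, OF this assms(2), of "fst G"] show ?thesis
    unfolding transforms_def prod.collapse by blast
qed

theorem theorem3:
  fixes synth :: "'op::primop synthesizer" and G\<^sub>0 :: "'op goal"
  assumes goal: "wf_goal G\<^sub>0"
    and sound: "sound_synthesizer synth"
    and requested: "\<And>G. (transforms synth)\<^sup>*\<^sup>* G\<^sub>0 G \<Longrightarrow> \<not> induction_friendly (snd G) \<Longrightarrow>
      \<exists>s v. requests (snd G) s v"
    and synthesized: "\<And>G s v. (transforms synth)\<^sup>*\<^sup>* G\<^sub>0 G \<Longrightarrow> requests (snd G) s v \<Longrightarrow>
      \<exists>f. synth s v f"
  shows "(\<exists>G. (transforms synth)\<^sup>*\<^sup>* G\<^sub>0 G \<and> induction_friendly (snd G)) \<and>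
    \<not> (\<exists>run. run 0 = G\<^sub>0 \<and> (\<forall>n. transforms synth (run n) (run (Suc n)))) \<and>
    (\<forall>G. (transforms synth)\<^sup>*\<^sup>* G\<^sub>0 G \<and> (\<nexists>G'. transforms synth G G') \<longrightarrow> induction_friendly (snd G))"
proof (intro conjI allI impI)
  \<comment> \<open>Outside the friendly forms some request exists, and its answer yields a further
    step.\<close>
  have normal: "induction_friendly (snd G)"
    if reach: "(transforms synth)\<^sup>*\<^sup>* G\<^sub>0 G" and stuck: "\<nexists>G'. transforms synth G G'" for G
  proof (rule ccontr)
    assume "\<not> induction_friendly (snd G)"
    then obtain s v where "requests (snd G) s v"
      using requested[OF reach] by blast
    moreover from this obtain f where "synth s v f"
      using synthesized[OF reach] by blast
    ultimately show False
      using requests_transforms stuck by blast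
  qed
  then show "induction_friendly (snd G)"
    if "(transforms synth)\<^sup>*\<^sup>* G\<^sub>0 G \<and> (\<nexists>G'. transforms synth G G')" for G
    using that by blast
  show "\<not> (\<exists>run. run 0 = G\<^sub>0 \<and> (\<forall>n. transforms synth (run n) (run (Suc n))))"
    using wf_transforms[of synth] unfolding wf_iff_no_infinite_down_chain by blast
  let ?R = "{G. (transforms synth)\<^sup>*\<^sup>* G\<^sub>0 G}"
  have "G\<^sub>0 \<in> ?R"
    by simp
  \<comment> \<open>A minimal reachable goal has no successor, because any successor would be
    reachable too.\<close>
  then obtain G where G: "G \<in> ?R" and minimal: "\<And>G'. transforms synth G G' \<Longrightarrow> G' \<notin> ?R"
    by (rule wfE_min[OF wf_transforms[of synth]]) simp
  have "\<nexists>G'. transforms synth G G'"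
    using G minimal by (blast intro: rtranclp.rtrancl_into_rtrancl)
  then show "\<exists>G. (transforms synth)\<^sup>*\<^sup>* G\<^sub>0 G \<and> induction_friendly (snd G)"
    using normal G by blast
qed

end
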